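(* Let $K$ be a finite field of characteristic different from $2$. Let $a, b \in K$ satisfy $b \neq 0$ and $a^2 - 4b \neq 0$, and let $E$ be the elliptic curve over $K$ given by $y^2 = x^3 + ax^2 + bx$. Let $\infty$ denote the identity of the group $E(K)$, and let $$S = \{P \in E(K) : P = \infty, \text{ or } P = (x,y) \text{ with } x \text{ a square in } K\}.$$ Then $$\#S = \begin{cases} \#E(K)/2 & \text{if } b \text{ is a square in } K, \\ \#E(K)/2 + 1 & \text{if } b \text{ is not a square in } K. \end{cases}$$
   Context: $E(K)$ denotes the group of $K$-rational points of $E$, including the point at infinity $\infty$, and $\#$ denotes cardinality. An element $x \in K$ is a square in $K$ if $x = t^2$ for some $t \in K$; in particular $0$ counts as a square, so the point $(0,0)$ always belongs to $S$. *)

theory Defs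
  imports "HOL-Computational_Algebra.Computational_Algebra"
begin

datatype 'k point = Infinity | Affine 'k 'k

text \<open>
  The projective curve \<open>y\<^sup>2 z = x\<^sup>3 + a x\<^sup>2 z + b x z\<^sup>2\<close> meets the line \<open>z = 0\<close> only in
  \<open>(0 : 1 : 0)\<close>, which is represented by \<^const>\<open>Infinity\<close>; it is the identity of the group of
  points. The other points are affine. The curve is nonsingular when the characteristic
  is not 2, \<open>b \<noteq> 0\<close> and \<open>a\<^sup>2 - 4 b \<noteq> 0\<close>; these are not part of the definition.
\<close>

definition curve_points :: "'k::field \<Rightarrow> 'k \<Rightarrow> 'k point set" where
  "curve_points a b =
     insert Infinity {Affine x y | x y. y ^ 2 = x ^ 3 + a * x ^ 2 + b * x}"

text \<open>Here \<^const>\<open>is_square\<close> is taken in \<open>'k\<close>, so that 0 is a square.\<close>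

definition square_points :: "'k::field \<Rightarrow> 'k \<Rightarrow> 'k point set" where
  "square_points a b =
     {P \<in> curve_points a b. P = Infinity \<or> (\<exists>x y. P = Affine x y \<and> is_square x)}"

lemma finite_curve_points [simp]: "finite (curve_points (a :: 'k::{field,finite}) b)"
proof -
  have "curve_points a b \<subseteq> insert Infinity ((\<lambda>(x, y). Affine x y) ` UNIV)"
    by (auto simp: curve_points_def)
  then show ?thesis
    by (rule finite_subset) simp
qed

end

theory Submission
  imports Defs "HOL-Library.Cardinality"
begin

text \<open>
  Write \<open>\<chi>\<close> for the quadratic character of \<open>K\<close>, with \<open>\<chi> 0 = 0\<close>. An element \<open>z\<close> has \<open>1 + \<chi> z\<close>
  square roots, so there are \<open>1 + \<chi> (f x)\<close> affine points above \<open>x\<close>, where \<open>f x = x (x\<^sup>2 + a x + b)\<close>.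
  For \<open>x \<noteq> 0\<close> the condition that \<open>x\<close> is a square has the indicator function \<open>(1 + \<chi> x) / 2\<close>. The
  points \<open>\<infinity>\<close> and \<open>(0, 0)\<close> lie in \<open>S\<close>, so multiplying out gives, with sums over \<open>x \<noteq> 0\<close>,

  \<open>2 #S - #E(K) = 2 + \<Sum> \<chi> x + \<Sum> \<chi> x \<chi> (f x)\<close>.

  The first sum is 0. In the second one a factor \<open>(\<chi> x)\<^sup>2 = 1\<close> splits off
  (\<open>quadratic_char_cancel\<close>), which leaves the values of \<open>\<chi>\<close> at the quadratic polynomial
  \<open>x\<^sup>2 + a x + b\<close>. Over all \<open>x\<close> these add up to \<open>-1\<close> (\<open>sum_quadratic_char_quadratic\<close>), because the
  affine conic \<open>y\<^sup>2 = x\<^sup>2 + a x + b\<close> is a hyperbola with \<open>#K - 1\<close> points (\<open>card_conic\<close>); the term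
  at \<open>x = 0\<close> is \<open>\<chi> b\<close>. Hence \<open>2 #S = #E(K) + 1 - \<chi> b\<close>, and \<open>\<chi> b = 1\<close> or \<open>\<chi> b = -1\<close> gives the
  two cases.
\<close>

section \<open>The quadratic character of a finite field\<close>

text \<open>
  Defined by counting square roots, so that sums of values become numbers of points on curves
  \<open>y\<^sup>2 = f x\<close>. In odd characteristic this is the usual character, with values 1 and \<open>-1\<close> at nonzero
  squares and nonsquares; in characteristic 2 it would vanish identically.
\<close>
definition quadratic_char :: "'k::{field,finite} \<Rightarrow> int" where
  "quadratic_char z = int (card {y. y ^ 2 = z}) - 1"

lemma card_square_roots: "int (card {y. y ^ 2 = z}) = 1 + quadratic_char z"
  by (simp add: quadratic_char_def)

lemma two_neq_zero:
  assumes "CHAR('k::{field,finite}) \<noteq> 2"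
  shows "(2 :: 'k) \<noteq> 0"
proof
  assume "(2 :: 'k) = 0"
  then have "of_nat 2 = (0 :: 'k)" by simp
  then have "CHAR('k) dvd 2" by (simp only: of_nat_eq_0_iff_char_dvd)
  with assms have "CHAR('k) = 1"
    using prime_nat_iff two_is_prime_nat by blast
  then show False by simp
qed

lemma quadratic_char_0 [simp]: "quadratic_char 0 = 0"
  by (simp add: quadratic_char_def)

lemma quadratic_char_nonsquare:
  assumes "\<not> is_square z"
  shows "quadratic_char z = -1"
proof -
  have "{y. y ^ 2 = z} = {}" using assms by (auto simp: is_nth_power_def)
  then show ?thesis by (simp add: quadratic_char_def)
qed

lemma quadratic_char_square:
  fixes z :: "'k::{field,finite}"
  assumes "(2 :: 'k) \<noteq> 0" "is_square z" "z \<noteq> 0"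
  shows "quadratic_char z = 1"
proof -
  obtain w where w: "z = w ^ 2" using assms(2) by (auto simp: is_nth_power_def)
  have "w \<noteq> - w"
  proof
    assume "w = - w"
    then have "2 * w = 0" by (metis add.right_inverse mult_2)
    with assms(1,3) w show False by simp
  qed
  moreover have "{y. y ^ 2 = z} = {w, - w}" using w by (auto simp: power2_eq_iff)
  ultimately show ?thesis by (simp add: quadratic_char_def)
qed

text \<open>Each element of \<open>K\<close> is a square root of exactly one element.\<close>
lemma sum_quadratic_char: "(\<Sum>z::'k::{field,finite}\<in>UNIV. quadratic_char z) = 0"
proof -
  have "(\<Sum>z::'k\<in>UNIV. card {y::'k. y ^ 2 = z}) = card (\<Union>z::'k. {y::'k. y ^ 2 = z})"
    by (rule card_UN_disjoint [symmetric]) auto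
  also have "(\<Union>z::'k. {y::'k. y ^ 2 = z}) = UNIV" by auto
  finally have "(\<Sum>z::'k\<in>UNIV. int (card {y::'k. y ^ 2 = z})) = int CARD('k)"
    by (metis of_nat_sum)
  then show ?thesis by (simp add: quadratic_char_def sum_subtractf)
qed

text \<open>
  Nonzero squares and nonsquares are equally many, since \<open>\<chi>\<close> sums to 0. Multiplication by a nonsquare
  maps the squares injectively into the nonsquares, hence onto them; by injectivity nothing is left
  for a nonsquare to be mapped to but the squares.
\<close>
lemma is_square_mult_nonsquares:
  fixes u v :: "'k::{field,finite}"
  assumes two: "(2 :: 'k) \<noteq> 0" and u: "\<not> is_square u" and v: "\<not> is_square v"
  shows "is_square (u * v)"
proof -
  let ?Q = "{z::'k. is_square z \<and> z \<noteq> 0}" and ?N = "{z::'k. \<not> is_square z}"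
  have u0: "u \<noteq> 0" using u by auto
  have "(UNIV :: 'k set) = insert 0 (?Q \<union> ?N)" by auto
  then have "0 = (\<Sum>z\<in>insert 0 (?Q \<union> ?N). quadratic_char z)"
    using sum_quadratic_char [where ?'k = 'k] by simp
  also have "\<dots> = (\<Sum>z\<in>?Q \<union> ?N. quadratic_char z)"
    by (subst sum.insert) auto
  also have "\<dots> = (\<Sum>z\<in>?Q. quadratic_char z) + (\<Sum>z\<in>?N. quadratic_char z)"
    by (rule sum.union_disjoint) auto
  also have "\<dots> = int (card ?Q) - int (card ?N)"
    by (simp add: quadratic_char_square two quadratic_char_nonsquare)
  finally have card: "card ?Q = card ?N" by simp
  have inj: "inj_on ((*) u) ?Q" using u0 by (auto simp: inj_on_def)
  have sub: "(*) u ` ?Q \<subseteq> ?N"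
  proof
    fix z assume "z \<in> (*) u ` ?Q"
    then obtain t where t: "z = u * t" "is_square t" "t \<noteq> 0" by blast
    from t(2) obtain s where "t = s ^ 2" by (auto simp: is_nth_power_def)
    with t have s: "z = u * s ^ 2" "s \<noteq> 0" by auto
    have "\<not> is_square z"
    proof
      assume "is_square z"
      then obtain r where "z = r ^ 2" by (auto simp: is_nth_power_def)
      with s have "u = (r / s) ^ 2" by (simp add: field_simps)
      with u show False by (auto simp: is_nth_power_def)
    qed
    then show "z \<in> ?N" by simp
  qed
  have "(*) u ` ?Q = ?N"
    using sub by (rule card_subset_eq [rotated]) (simp_all add: card_image inj card)
  show ?thesis
  proof (rule ccontr)
    assume "\<not> is_square (u * v)"
    with \<open>(*) u ` ?Q = ?N\<close> have "u * v \<in> (*) u ` ?Q" by simp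
    then obtain s where "is_square s" "u * v = u * s" by auto
    with u0 v show False by simp
  qed
qed

text \<open>
  Special case of multiplicativity of \<open>\<chi>\<close>: \<open>\<chi> x \<cdot> \<chi> (x q) = \<chi> x\<^sup>2 \<cdot> \<chi> q\<close>. If \<open>x\<close> is a square then \<open>x q\<close>
  and \<open>q\<close> are squares or nonsquares together; if it is not and \<open>q \<noteq> 0\<close>, exactly one of them is a
  square.
\<close>
lemma quadratic_char_cancel:
  fixes x q :: "'k::{field,finite}"
  assumes two: "(2 :: 'k) \<noteq> 0" and x: "x \<noteq> 0"
  shows "quadratic_char x * quadratic_char (x * q) = quadratic_char q"
proof -
  have transfer: "is_square w" if "is_square x" "is_square (x * w)" for w
  proof -
    obtain s r where "x = s ^ 2" "x * w = r ^ 2" using \<open>is_square x\<close> \<open>is_square (x * w)\<close>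
      by (auto simp: is_nth_power_def)
    with x have "w = (r / s) ^ 2" by (auto simp: field_simps)
    then show ?thesis by (auto simp: is_nth_power_def)
  qed
  have mult: "is_square (v * w)" if "is_square v" "is_square w" for v w :: 'k
    using that by (rule is_nth_power_mult)
  show ?thesis
  proof (cases "q = 0")
    case False
    have "is_square (x * q) \<longleftrightarrow> is_square q" if "is_square x"
      using that transfer mult by blast
    moreover have "is_square (x * q) \<longleftrightarrow> \<not> is_square q" if "\<not> is_square x"
    proof -
      have "\<not> is_square (x * q)" if "is_square q"
      proof
        assume "is_square (x * q)"
        obtain s r where "q = s ^ 2" "x * q = r ^ 2"
          using \<open>is_square q\<close> \<open>is_square (x * q)\<close> by (auto simp: is_nth_power_def)
        with False have "x = (r / s) ^ 2" by (auto simp: field_simps)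
        with \<open>\<not> is_square x\<close> show False by (auto simp: is_nth_power_def)
      qed
      with is_square_mult_nonsquares [OF two that] show ?thesis by blast
    qed
    ultimately show ?thesis
      using x False two
      by (cases "is_square x"; cases "is_square q")
         (simp_all add: quadratic_char_square quadratic_char_nonsquare)
  qed simp
qed

section \<open>Character sums of quadratic polynomials\<close>

lemma card_Sigma_conv_sum:
  fixes P :: "'a::finite \<Rightarrow> 'b::finite \<Rightarrow> bool"
  shows "card {(x, y). x \<in> A \<and> P x y} = (\<Sum>x\<in>A. card {y. P x y})"
proof -
  have "{(x, y). x \<in> A \<and> P x y} = (SIGMA x:A. {y. P x y})" by auto
  then show ?thesis by simp
qed

text \<open>
  The equation reads \<open>(2 y - 2 x - a) (2 y + 2 x + a) = 4 b - a\<^sup>2\<close>, with a nonzero right-hand side, so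
  the first factor can be any nonzero \<open>u\<close> and determines the second one.
\<close>
lemma card_conic:
  fixes a b :: "'k::{field,finite}"
  assumes two: "(2 :: 'k) \<noteq> 0" and disc: "a ^ 2 - 4 * b \<noteq> 0"
  shows "card {(x, y). y ^ 2 = x ^ 2 + a * x + b} = CARD('k) - 1"
proof -
  have four: "(4 :: 'k) \<noteq> 0"
  proof -
    have "(4 :: 'k) = 2 * 2" by simp
    with two show ?thesis by (metis no_zero_divisors)
  qed
  define d where "d = 4 * b - a ^ 2"
  have d: "d \<noteq> 0" using disc by (simp add: d_def)
  let ?C = "{(x, y). y ^ 2 = x ^ 2 + a * x + b}"
  let ?f = "\<lambda>(x, y). 2 * y - 2 * x - a"
  let ?g = "\<lambda>u. ((d / u - u - 2 * a) / 4, (u + d / u) / 4)"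
  have factor: "(2 * y - 2 * x - a) * (2 * y + 2 * x + a) = d + 4 * (y ^ 2 - (x ^ 2 + a * x + b))"
    for x y
    by (simp add: d_def power2_eq_square algebra_simps)
  have g: "?g u \<in> ?C \<and> ?f (?g u) = u" if u: "u \<noteq> 0" for u
  proof -
    define x where "x = (d / u - u - 2 * a) / 4"
    define y where "y = (u + d / u) / 4"
    have x4: "4 * x = d / u - u - 2 * a" and y4: "4 * y = u + d / u"
      using four by (simp_all add: x_def y_def)
    have "2 * (2 * y - 2 * x - a) = 4 * y - 4 * x - 2 * a" by (simp add: algebra_simps)
    also have "\<dots> = 2 * u" by (simp only: x4 y4) simp
    finally have 1: "2 * y - 2 * x - a = u" using two by (metis mult_left_cancel)
    have "2 * (2 * y + 2 * x + a) = 4 * y + 4 * x + 2 * a" by (simp add: algebra_simps)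
    also have "\<dots> = 2 * (d / u)" by (simp only: x4 y4) simp
    finally have 2: "2 * y + 2 * x + a = d / u" using two by (metis mult_left_cancel)
    have "d = d + 4 * (y ^ 2 - (x ^ 2 + a * x + b))"
      using factor [of y x] u unfolding 1 2 by simp
    then have "4 * (y ^ 2 - (x ^ 2 + a * x + b)) = 0" by (metis add_cancel_right_right)
    with four have "y ^ 2 - (x ^ 2 + a * x + b) = 0" by (metis mult_eq_0_iff)
    then have "y ^ 2 = x ^ 2 + a * x + b" by (simp only: right_minus_eq)
    with 1 show ?thesis by (simp flip: x_def y_def)
  qed
  have f: "?f p \<noteq> 0 \<and> ?g (?f p) = p" if p: "p \<in> ?C" for p
  proof -
    obtain x y where xy: "p = (x, y)" by (cases p)
    define u where "u = 2 * y - 2 * x - a"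
    have prod: "u * (2 * y + 2 * x + a) = d"
      using factor [of y x] p xy by (simp add: u_def)
    with d have u0: "u \<noteq> 0" by auto
    then have v: "d / u = 2 * y + 2 * x + a" by (simp flip: prod)
    have "d / u - u - 2 * a = 4 * x" "u + d / u = 4 * y"
      unfolding v by (simp_all add: u_def algebra_simps)
    with four u0 show ?thesis by (simp add: xy flip: u_def)
  qed
  have "bij_betw ?f ?C (UNIV - {0})"
    by (rule bij_betwI [where g = ?g]) (use f g in blast)+
  then have "card ?C = card (UNIV - {0 :: 'k})" by (rule bij_betw_same_card)
  then show ?thesis by simp
qed

lemma sum_quadratic_char_quadratic:
  fixes a b :: "'k::{field,finite}"
  assumes "(2 :: 'k) \<noteq> 0" "a ^ 2 - 4 * b \<noteq> 0"
  shows "(\<Sum>x\<in>UNIV. quadratic_char (x ^ 2 + a * x + b)) = -1"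
proof -
  have "int (CARD('k) - 1) = (\<Sum>x\<in>UNIV. int (card {y. y ^ 2 = x ^ 2 + a * x + b}))"
    using card_conic [OF assms] card_Sigma_conv_sum [of UNIV "\<lambda>x y. y ^ 2 = x ^ 2 + a * x + b"]
    by simp
  also have "\<dots> = int CARD('k) + (\<Sum>x\<in>UNIV. quadratic_char (x ^ 2 + a * x + b))"
    by (simp add: card_square_roots sum.distrib)
  finally show ?thesis by (simp add: of_nat_diff Suc_leI)
qed

section \<open>Counting the points of the curve\<close>

lemma card_points_over:
  fixes a b :: "'k::{field,finite}"
  shows "int (card (insert Infinity {Affine x y | x y. x \<in> A \<and> y ^ 2 = x ^ 3 + a * x ^ 2 + b * x}))
    = 1 + (\<Sum>x\<in>A. 1 + quadratic_char (x * (x ^ 2 + a * x + b)))"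
proof -
  let ?P = "\<lambda>x y. y ^ 2 = x ^ 3 + a * x ^ 2 + b * x"
  have img: "{Affine x y | x y. x \<in> A \<and> ?P x y} = (\<lambda>(x, y). Affine x y) ` {(x, y). x \<in> A \<and> ?P x y}"
    by auto
  have "card {Affine x y | x y. x \<in> A \<and> ?P x y} = card {(x, y). x \<in> A \<and> ?P x y}"
    unfolding img by (rule card_image) (auto simp: inj_on_def)
  also have "\<dots> = (\<Sum>x\<in>A. card {y. ?P x y})" by (rule card_Sigma_conv_sum)
  finally have "int (card {Affine x y | x y. x \<in> A \<and> ?P x y})
      = (\<Sum>x\<in>A. 1 + quadratic_char (x ^ 3 + a * x ^ 2 + b * x))"
    by (simp add: card_square_roots)
  moreover have "x ^ 3 + a * x ^ 2 + b * x = x * (x ^ 2 + a * x + b)" for x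
    by (simp add: power2_eq_square power3_eq_cube algebra_simps)
  moreover have "finite {Affine x y | x y. x \<in> A \<and> ?P x y}" unfolding img by simp
  moreover have "Infinity \<notin> {Affine x y | x y. x \<in> A \<and> ?P x y}" by simp
  ultimately show ?thesis by simp
qed

text \<open>
  For \<open>x \<noteq> 0\<close> twice the indicator function of the squares is \<open>1 + \<chi> x\<close>, and the expansion of
  \<open>(1 + \<chi> x) (1 + \<chi> (x q))\<close> ends in \<open>\<chi> q\<close> by \<open>quadratic_char_cancel\<close>. Only \<open>x = 0\<close> needs a
  correction: the point \<open>(0, 0)\<close> counts 2 on the left, and the expanded form gives \<open>1 + \<chi> b\<close>.
\<close>
lemma double_card_square_points:
  fixes a b :: "'k::{field,finite}"
  assumes two: "(2 :: 'k) \<noteq> 0" and disc: "a ^ 2 - 4 * b \<noteq> 0"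
  shows "2 * int (card (square_points a b)) = int (card (curve_points a b)) + 1 - quadratic_char b"
proof -
  let ?q = "\<lambda>x::'k. x ^ 2 + a * x + b"
  let ?r = "\<lambda>x. 1 + quadratic_char (x * ?q x)"
  have E: "int (card (curve_points a b)) = 1 + (\<Sum>x\<in>UNIV. ?r x)"
    using card_points_over [of UNIV a b] by (simp add: curve_points_def)
  have "square_points a b
      = insert Infinity {Affine x y | x y. x \<in> {x. is_square x} \<and> y ^ 2 = x ^ 3 + a * x ^ 2 + b * x}"
    by (auto simp: square_points_def curve_points_def)
  then have "int (card (square_points a b)) = 1 + (\<Sum>x | is_square x. ?r x)"
    by (simp only: card_points_over)
  also have "(\<Sum>x | is_square x. ?r x) = (\<Sum>x\<in>UNIV. if is_square x then ?r x else 0)"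
    by (simp add: sum.If_cases)
  finally have "2 * int (card (square_points a b))
      = 2 + (\<Sum>x\<in>UNIV. 2 * (if is_square x then ?r x else 0))"
    by (simp add: sum_distrib_left)
  also have "(\<Sum>x\<in>UNIV. 2 * (if is_square x then ?r x else 0))
      = (\<Sum>x\<in>UNIV. ?r x + quadratic_char x + quadratic_char (?q x)
                  + (if x = 0 then 1 - quadratic_char b else 0))"
  proof (rule sum.cong [OF refl])
    fix x :: 'k
    show "2 * (if is_square x then ?r x else 0)
      = ?r x + quadratic_char x + quadratic_char (?q x)
        + (if x = 0 then 1 - quadratic_char b else 0)"
    proof (cases "x = 0")
      case False
      then show ?thesis
        using quadratic_char_cancel [OF two False, of "?q x"]
        by (cases "is_square x") (auto simp: quadratic_char_square two quadratic_char_nonsquare)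
    qed simp
  qed
  also have "\<dots> = (\<Sum>x\<in>UNIV. ?r x) + 0 + (-1) + (1 - quadratic_char b)"
    using sum_quadratic_char [where ?'k = 'k] sum_quadratic_char_quadratic [OF assms]
    by (simp add: sum.distrib)
  finally show ?thesis using E by simp
qed

theorem theorem2p1:
  fixes a b :: "'k::{field,finite}"
  assumes "CHAR('k) \<noteq> 2"
    and "b \<noteq> 0"
    and "a ^ 2 - 4 * b \<noteq> 0"
  shows "real (card (square_points a b)) =
    (if is_square b then real (card (curve_points a b)) / 2
     else real (card (curve_points a b)) / 2 + 1)"
proof -
  have two: "(2 :: 'k) \<noteq> 0" using assms(1) by (rule two_neq_zero)
  note count = double_card_square_points [OF two assms(3)]
  show ?thesis
  proof (cases "is_square b")
    case True
    then show ?thesis using count quadratic_char_square [OF two True assms(2)] by simp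
  next
    case False
    then show ?thesis using count quadratic_char_nonsquare [OF False] by simp
  qed
qed

end
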